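(* Let $A\subset B$ be an integral ring extension of integral domains. For any $b\in B$, there exists a maximal ideal $\mathfrak{m}\in\mathrm{Max}(A)$ such that $\mathrm{id}_A(b)=\mathrm{id}_{A_{\mathfrak{m}}}(b/1)$. In particular, $$\mathrm{d}_A(B)=\sup\{\mathrm{d}_{A_{\mathfrak{m}}}(B_{\mathfrak{m}})\mid \mathfrak{m}\in\mathrm{Max}(A)\}=\sup\{\mathrm{d}_{A_{\mathfrak{p}}}(B_{\mathfrak{p}})\mid \mathfrak{p}\in\mathrm{Spec}(A)\}.$$ Furthermore, if $\mathrm{d}_A(B)$ is finite, then there exists $\mathfrak{m}\in\mathrm{Max}(A)$ such that $\mathrm{d}_A(B)=\mathrm{d}_{A_{\mathfrak{m}}}(B_{\mathfrak{m}})$.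
   Context: All rings are commutative with unity. For an integral ring extension $A\subset B$ of integral domains and $b\in B$, the integral degree of $b$ over $A$, denoted $\mathrm{id}_A(b)$, is the minimum integer $n\geq 1$ such that $b$ is a root of a monic polynomial of degree $n$ in $A[T]$. The integral degree of $B$ over $A$ is $\mathrm{d}_A(B)=\sup\{\mathrm{id}_A(b)\mid b\in B\}$ (possibly $\infty$). For $\mathfrak{p}\in\mathrm{Spec}(A)$, $B_{\mathfrak{p}}$ denotes the localization of $B$ at the multiplicative set $A\setminus\mathfrak{p}$, and $b/1$ the image of $b$ in it; the extension $A_{\mathfrak{p}}\subset B_{\mathfrak{p}}$ is integral. $\mathrm{Max}(A)$ is the set of maximal ideals of $A$. *)

theory Defs
  imports "HOL-Algebra.Algebra" "HOL-Library.Extended_Nat"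
begin

section \<open>Integral elements and integral degree\<close>

text \<open>A subring of \<open>R\<close> is a set \<open>A\<close> with \<^prop>\<open>subring A R\<close>, and \<open>A\<close>, regarded as a ring, is
  \<open>R\<lparr>carrier := A\<rparr>\<close>.  Polynomials in \<open>A[X]\<^bsub>R\<^esub>\<close> are lists of coefficients, leading coefficient
  first.  As \<^term>\<open>degree\<close> and \<^term>\<open>lead_coeff\<close> say nothing useful about the zero polynomial
  \<^term>\<open>[]\<close>, it is excluded explicitly.\<close>

definition monic_polys :: "('a, 'c) ring_scheme \<Rightarrow> 'a set \<Rightarrow> 'a list set"
  where "monic_polys R A = {p \<in> carrier (A[X]\<^bsub>R\<^esub>). p \<noteq> [] \<and> lead_coeff p = \<one>\<^bsub>R\<^esub>}"

definition integral_over :: "('a, 'c) ring_scheme \<Rightarrow> 'a set \<Rightarrow> 'a \<Rightarrow> bool"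
  where "integral_over R A b \<longleftrightarrow> (\<exists>p \<in> monic_polys R A. ring.eval R p b = \<zero>\<^bsub>R\<^esub>)"

definition integral_extension :: "('a, 'c) ring_scheme \<Rightarrow> 'a set \<Rightarrow> bool"
  where "integral_extension R A \<longleftrightarrow>
    cring R \<and> subring A R \<and> (\<forall>b \<in> carrier R. integral_over R A b)"

text \<open>\<open>id\<^sub>A(b)\<close>; the minimum exists exactly when \<open>b\<close> is integral over \<open>A\<close>.\<close>

definition integral_degree_elem :: "('a, 'c) ring_scheme \<Rightarrow> 'a set \<Rightarrow> 'a \<Rightarrow> nat"
  where "integral_degree_elem R A b =
    (LEAST n. n \<ge> 1 \<and> (\<exists>p \<in> monic_polys R A. degree p = n \<and> ring.eval R p b = \<zero>\<^bsub>R\<^esub>))"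

text \<open>\<open>d\<^sub>A(R)\<close>\<close>

definition integral_degree :: "('a, 'c) ring_scheme \<Rightarrow> 'a set \<Rightarrow> enat"
  where "integral_degree R A = (SUP b \<in> carrier R. enat (integral_degree_elem R A b))"


section \<open>Localization\<close>

text \<open>The localization of a commutative ring \<open>R\<close> at a multiplicative set \<open>S\<close>: the fraction
  \<open>a/s\<close> is the class of the pair \<open>(a, s)\<close>.\<close>

definition frac_rel :: "('a, 'c) ring_scheme \<Rightarrow> 'a set \<Rightarrow> (('a \<times> 'a) \<times> ('a \<times> 'a)) set"
  where "frac_rel R S = {((a, s), (b, t)). a \<in> carrier R \<and> s \<in> S \<and> b \<in> carrier R \<and> t \<in> S \<and>
    (\<exists>u \<in> S. u \<otimes>\<^bsub>R\<^esub> (t \<otimes>\<^bsub>R\<^esub> a \<ominus>\<^bsub>R\<^esub> s \<otimes>\<^bsub>R\<^esub> b) = \<zero>\<^bsub>R\<^esub>)}"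

definition fraction :: "('a, 'c) ring_scheme \<Rightarrow> 'a set \<Rightarrow> 'a \<Rightarrow> 'a \<Rightarrow> ('a \<times> 'a) set"
  where "fraction R S a s = frac_rel R S `` {(a, s)}"

text \<open>As usual for quotients (cf. \<open>UN_equiv_class2\<close>), an operation on classes is the union of
  the results over all representatives, all of which coincide.\<close>

definition localization :: "('a, 'c) ring_scheme \<Rightarrow> 'a set \<Rightarrow> ('a \<times> 'a) set ring"
  where "localization R S = \<lparr>
    carrier = (carrier R \<times> S) // frac_rel R S,
    monoid.mult = (\<lambda>U V. \<Union>(a, s) \<in> U. \<Union>(b, t) \<in> V.
      fraction R S (a \<otimes>\<^bsub>R\<^esub> b) (s \<otimes>\<^bsub>R\<^esub> t)),
    one = fraction R S \<one>\<^bsub>R\<^esub> \<one>\<^bsub>R\<^esub>,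
    ring.zero = fraction R S \<zero>\<^bsub>R\<^esub> \<one>\<^bsub>R\<^esub>,
    ring.add = (\<lambda>U V. \<Union>(a, s) \<in> U. \<Union>(b, t) \<in> V.
      fraction R S (t \<otimes>\<^bsub>R\<^esub> a \<oplus>\<^bsub>R\<^esub> s \<otimes>\<^bsub>R\<^esub> b) (s \<otimes>\<^bsub>R\<^esub> t))\<rparr>"

text \<open>For a subring \<open>A\<close> of \<open>R\<close> and \<open>S \<subseteq> A\<close>, the localization of \<open>A\<close> at \<open>S\<close> as a subring of the
  localization of \<open>R\<close> at \<open>S\<close>; see \<open>localization_subring_iso\<close> below.\<close>

definition localization_subring ::
    "('a, 'c) ring_scheme \<Rightarrow> 'a set \<Rightarrow> 'a set \<Rightarrow> ('a \<times> 'a) set set"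
  where "localization_subring R A S = {fraction R S a s | a s. a \<in> A \<and> s \<in> S}"

lemma frac_relI:
  assumes "a \<in> carrier R" "s \<in> S" "b \<in> carrier R" "t \<in> S" "u \<in> S"
    and "u \<otimes>\<^bsub>R\<^esub> (t \<otimes>\<^bsub>R\<^esub> a \<ominus>\<^bsub>R\<^esub> s \<otimes>\<^bsub>R\<^esub> b) = \<zero>\<^bsub>R\<^esub>"
  shows "((a, s), (b, t)) \<in> frac_rel R S"
  using assms unfolding frac_rel_def by blast

context cring
begin

context
  fixes S
  assumes S: "submonoid S R"
begin

private lemma Sc: "s \<in> S \<Longrightarrow> s \<in> carrier R"
  and S1: "\<one> \<in> S"
  and Sm: "s \<in> S \<Longrightarrow> t \<in> S \<Longrightarrow> s \<otimes> t \<in> S"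
  using submonoid.subset[OF S] submonoid.one_closed[OF S] submonoid.m_closed[OF S] by auto

lemma equiv_frac_rel: "equiv (carrier R \<times> S) (frac_rel R S)"
proof (rule equivI)
  show "frac_rel R S \<subseteq> (carrier R \<times> S) \<times> (carrier R \<times> S)"
    unfolding frac_rel_def by auto
  show "refl_on (carrier R \<times> S) (frac_rel R S)"
  proof (rule refl_onI, clarify)
    fix a s assume "a \<in> carrier R" "s \<in> S"
    then show "((a, s), (a, s)) \<in> frac_rel R S"
      by (intro frac_relI[OF _ _ _ _ S1]) (simp_all add: Sc minus_eq r_neg)
  qed
  show "sym (frac_rel R S)"
  proof (rule symI, clarify)
    fix a s b t assume "((a, s), (b, t)) \<in> frac_rel R S"
    then obtain u where *: "a \<in> carrier R" "s \<in> S" "b \<in> carrier R" "t \<in> S" "u \<in> S"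
      "u \<otimes> (t \<otimes> a \<ominus> s \<otimes> b) = \<zero>" unfolding frac_rel_def by auto
    have "u \<otimes> (s \<otimes> b \<ominus> t \<otimes> a) = \<ominus> (u \<otimes> (t \<otimes> a \<ominus> s \<otimes> b))"
      using *(1-5) Sc by algebra
    then show "((b, t), (a, s)) \<in> frac_rel R S"
      using * by (intro frac_relI[of _ _ _ _ _ _ u]) simp_all
  qed
  show "trans (frac_rel R S)"
  proof (rule transI, clarify)
    fix a s b t c r
    assume "((a, s), (b, t)) \<in> frac_rel R S" "((b, t), (c, r)) \<in> frac_rel R S"
    then obtain u v where *: "a \<in> carrier R" "s \<in> S" "b \<in> carrier R" "t \<in> S" "u \<in> S"
        "c \<in> carrier R" "r \<in> S" "v \<in> S"
      and e: "u \<otimes> (t \<otimes> a \<ominus> s \<otimes> b) = \<zero>" "v \<otimes> (r \<otimes> b \<ominus> t \<otimes> c) = \<zero>"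
      unfolding frac_rel_def by auto
    have "(u \<otimes> v \<otimes> t) \<otimes> (r \<otimes> a \<ominus> s \<otimes> c)
        = v \<otimes> r \<otimes> (u \<otimes> (t \<otimes> a \<ominus> s \<otimes> b)) \<oplus> u \<otimes> s \<otimes> (v \<otimes> (r \<otimes> b \<ominus> t \<otimes> c))"
      using * Sc by algebra
    also have "\<dots> = \<zero>" using e * Sc by simp
    finally show "((a, s), (c, r)) \<in> frac_rel R S"
      using * by (intro frac_relI[of _ _ _ _ _ _ "u \<otimes> v \<otimes> t"]) (simp_all add: Sm)
  qed
qed

lemma fraction_eq_iff:
  assumes "a \<in> carrier R" "s \<in> S" "b \<in> carrier R" "t \<in> S"
  shows "fraction R S a s = fraction R S b t \<longleftrightarrow> (\<exists>u \<in> S. u \<otimes> (t \<otimes> a \<ominus> s \<otimes> b) = \<zero>)"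
  unfolding fraction_def using assms
  by (subst eq_equiv_class_iff[OF equiv_frac_rel]) (auto simp: frac_rel_def)

lemma fraction_eqI:
  assumes "a \<in> carrier R" "s \<in> S" "b \<in> carrier R" "t \<in> S" "t \<otimes> a = s \<otimes> b"
  shows "fraction R S a s = fraction R S b t"
proof -
  have "\<one> \<otimes> (t \<otimes> a \<ominus> s \<otimes> b) = \<zero>" using assms Sc by (simp add: minus_eq r_neg)
  then show ?thesis using fraction_eq_iff[OF assms(1-4)] S1 by blast
qed

lemma fraction_in_localization:
  "a \<in> carrier R \<Longrightarrow> s \<in> S \<Longrightarrow> fraction R S a s \<in> carrier (localization R S)"
  by (auto simp: localization_def fraction_def intro: quotientI)

lemma localization_cases:
  assumes "U \<in> carrier (localization R S)"
  obtains a s where "a \<in> carrier R" "s \<in> S" "U = fraction R S a s"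
  using assms by (auto simp: localization_def fraction_def elim!: quotientE)

lemma zero_localization: "\<zero>\<^bsub>localization R S\<^esub> = fraction R S \<zero> \<one>"
  and one_localization: "\<one>\<^bsub>localization R S\<^esub> = fraction R S \<one> \<one>"
  by (simp_all add: localization_def)

lemma mult_localization:
  assumes "a \<in> carrier R" "s \<in> S" "b \<in> carrier R" "t \<in> S"
  shows "fraction R S a s \<otimes>\<^bsub>localization R S\<^esub> fraction R S b t = fraction R S (a \<otimes> b) (s \<otimes> t)"
proof -
  have "congruent2 (frac_rel R S) (frac_rel R S)
    (\<lambda>x y. case (x, y) of ((a, s), (b, t)) \<Rightarrow> fraction R S (a \<otimes> b) (s \<otimes> t))"
  proof (rule congruent2I', clarsimp)
    fix a s a' s' b t b' t'
    assume "((a, s), (a', s')) \<in> frac_rel R S" "((b, t), (b', t')) \<in> frac_rel R S"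
    then obtain u v where *: "a \<in> carrier R" "s \<in> S" "a' \<in> carrier R" "s' \<in> S" "u \<in> S"
        "b \<in> carrier R" "t \<in> S" "b' \<in> carrier R" "t' \<in> S" "v \<in> S"
      and e: "u \<otimes> (s' \<otimes> a \<ominus> s \<otimes> a') = \<zero>" "v \<otimes> (t' \<otimes> b \<ominus> t \<otimes> b') = \<zero>"
      unfolding frac_rel_def by auto
    have "(u \<otimes> v) \<otimes> ((s' \<otimes> t') \<otimes> (a \<otimes> b) \<ominus> (s \<otimes> t) \<otimes> (a' \<otimes> b'))
      = v \<otimes> t' \<otimes> b \<otimes> (u \<otimes> (s' \<otimes> a \<ominus> s \<otimes> a')) \<oplus> u \<otimes> s \<otimes> a' \<otimes> (v \<otimes> (t' \<otimes> b \<ominus> t \<otimes> b'))"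
      using * Sc by algebra
    also have "\<dots> = \<zero>" using e * Sc by simp
    finally show "fraction R S (a \<otimes> b) (s \<otimes> t) = fraction R S (a' \<otimes> b') (s' \<otimes> t')"
      using * by (subst fraction_eq_iff) (auto simp: Sm)
  qed
  from UN_equiv_class2[OF equiv_frac_rel equiv_frac_rel this, of "(a, s)" "(b, t)"]
  show ?thesis using assms by (simp add: localization_def fraction_def[of R S a s] fraction_def[of R S b t] case_prod_unfold)
qed

lemma add_localization:
  assumes "a \<in> carrier R" "s \<in> S" "b \<in> carrier R" "t \<in> S"
  shows "fraction R S a s \<oplus>\<^bsub>localization R S\<^esub> fraction R S b t
    = fraction R S (t \<otimes> a \<oplus> s \<otimes> b) (s \<otimes> t)"
proof -
  have "congruent2 (frac_rel R S) (frac_rel R S)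
    (\<lambda>x y. case (x, y) of ((a, s), (b, t)) \<Rightarrow> fraction R S (t \<otimes> a \<oplus> s \<otimes> b) (s \<otimes> t))"
  proof (rule congruent2I', clarsimp)
    fix a s a' s' b t b' t'
    assume "((a, s), (a', s')) \<in> frac_rel R S" "((b, t), (b', t')) \<in> frac_rel R S"
    then obtain u v where *: "a \<in> carrier R" "s \<in> S" "a' \<in> carrier R" "s' \<in> S" "u \<in> S"
        "b \<in> carrier R" "t \<in> S" "b' \<in> carrier R" "t' \<in> S" "v \<in> S"
      and e: "u \<otimes> (s' \<otimes> a \<ominus> s \<otimes> a') = \<zero>" "v \<otimes> (t' \<otimes> b \<ominus> t \<otimes> b') = \<zero>"
      unfolding frac_rel_def by auto
    have "(u \<otimes> v) \<otimes> ((s' \<otimes> t') \<otimes> (t \<otimes> a \<oplus> s \<otimes> b) \<ominus> (s \<otimes> t) \<otimes> (t' \<otimes> a' \<oplus> s' \<otimes> b'))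
      = v \<otimes> t \<otimes> t' \<otimes> (u \<otimes> (s' \<otimes> a \<ominus> s \<otimes> a')) \<oplus> u \<otimes> s \<otimes> s' \<otimes> (v \<otimes> (t' \<otimes> b \<ominus> t \<otimes> b'))"
      using * Sc by algebra
    also have "\<dots> = \<zero>" using e * Sc by simp
    finally show "fraction R S (t \<otimes> a \<oplus> s \<otimes> b) (s \<otimes> t)
        = fraction R S (t' \<otimes> a' \<oplus> s' \<otimes> b') (s' \<otimes> t')"
      using * by (subst fraction_eq_iff) (auto simp: Sm Sc)
  qed
  from UN_equiv_class2[OF equiv_frac_rel equiv_frac_rel this, of "(a, s)" "(b, t)"]
  show ?thesis using assms by (simp add: localization_def fraction_def[of R S a s] fraction_def[of R S b t] case_prod_unfold)
qed

lemmas localization_simps =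
  fraction_in_localization zero_localization one_localization mult_localization add_localization

lemma localization_cring: "cring (localization R S)"
proof (rule cringI)
  show "abelian_group (localization R S)"
  proof (rule abelian_groupI)
    fix U assume "U \<in> carrier (localization R S)"
    then obtain a s where U: "a \<in> carrier R" "s \<in> S" "U = fraction R S a s"
      by (rule localization_cases)
    show "\<exists>V \<in> carrier (localization R S). V \<oplus>\<^bsub>localization R S\<^esub> U = \<zero>\<^bsub>localization R S\<^esub>"
    proof
      show "fraction R S (\<ominus> a) s \<in> carrier (localization R S)" using U by (simp add: localization_simps)
      show "fraction R S (\<ominus> a) s \<oplus>\<^bsub>localization R S\<^esub> U = \<zero>\<^bsub>localization R S\<^esub>"
        using U by (simp add: localization_simps) (intro fraction_eqI; simp add: Sm Sc S1 l_neg r_minus)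
    qed
  next
    fix U V W assume "U \<in> carrier (localization R S)" "V \<in> carrier (localization R S)"
      "W \<in> carrier (localization R S)"
    then show "U \<oplus>\<^bsub>localization R S\<^esub> V \<oplus>\<^bsub>localization R S\<^esub> W
      = U \<oplus>\<^bsub>localization R S\<^esub> (V \<oplus>\<^bsub>localization R S\<^esub> W)"
      by (elim localization_cases, simp add: localization_simps Sm Sc)
        (intro fraction_eqI; (simp add: Sm Sc; fail)?; use Sc in algebra)
  next
    fix U V assume "U \<in> carrier (localization R S)" "V \<in> carrier (localization R S)"
    then show "U \<oplus>\<^bsub>localization R S\<^esub> V = V \<oplus>\<^bsub>localization R S\<^esub> U"
      by (elim localization_cases, simp add: localization_simps Sm Sc)
        (intro fraction_eqI; (simp add: Sm Sc; fail)?; use Sc in algebra)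
  qed (auto elim!: localization_cases simp: localization_simps Sm Sc S1)
  show "comm_monoid (localization R S)"
    by (rule comm_monoidI)
      (auto elim!: localization_cases simp: localization_simps Sm Sc S1 m_ac)
next
  fix U V W assume "U \<in> carrier (localization R S)" "V \<in> carrier (localization R S)"
    "W \<in> carrier (localization R S)"
  then show "(U \<oplus>\<^bsub>localization R S\<^esub> V) \<otimes>\<^bsub>localization R S\<^esub> W
    = U \<otimes>\<^bsub>localization R S\<^esub> W \<oplus>\<^bsub>localization R S\<^esub> V \<otimes>\<^bsub>localization R S\<^esub> W"
    by (elim localization_cases, simp add: localization_simps Sm Sc)
      (intro fraction_eqI; (simp add: Sm Sc; fail)?; use Sc in algebra)
qed

end

lemma localization_subring_iso:
  assumes A: "subring A R" and SA: "submonoid S R" "S \<subseteq> A"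
  shows "(\<lambda>U. frac_rel R S `` U) \<in> ring_iso (localization (R\<lparr>carrier := A\<rparr>) S)
    ((localization R S)\<lparr>carrier := localization_subring R A S\<rparr>)"
proof -
  let ?A = "R\<lparr>carrier := A\<rparr>"
  interpret A: cring ?A
    using subcring_iff[of A] subcringI'[OF A] subringE(1)[OF A] by blast
  have S: "submonoid S ?A"
    using SA by (auto simp: submonoid_def)
  note AR = subsetD[OF subringE(1)[OF A]]
  note Am = subringE(6,7)[OF A]
  note sub = subsetD[OF SA(2)]
  have Sm: "s \<otimes> t \<in> S" if "s \<in> S" "t \<in> S" for s t
    using submonoid.m_closed[OF SA(1)] that .
  have S1: "\<one> \<in> S" using submonoid.one_closed[OF SA(1)] .
  have minus: "x \<ominus>\<^bsub>?A\<^esub> y = x \<ominus> y" if "x \<in> A" "y \<in> A" for x y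
  proof -
    have "\<ominus>\<^bsub>?A\<^esub> y = \<ominus> y"
      using that subringE(5)[OF A] AR r_neg by (intro A.minus_equality) (auto simp: l_neg)
    then show ?thesis using that by (simp add: a_minus_def)
  qed
  have rel: "frac_rel ?A S \<subseteq> frac_rel R S"
    unfolding frac_rel_def using minus Am sub AR by (fastforce simp: minus)
  have img: "frac_rel R S `` fraction ?A S a s = fraction R S a s" if "a \<in> A" "s \<in> S" for a s
  proof -
    have "(a, s) \<in> fraction ?A S a s"
      unfolding fraction_def using equiv_class_self[OF A.equiv_frac_rel[OF S]] that by simp
    moreover have "fraction ?A S a s \<subseteq> fraction R S a s"
      unfolding fraction_def using rel by auto
    moreover have "trans (frac_rel R S)"
      using equiv_frac_rel[OF SA(1)] by (auto elim: equivE)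
    ultimately show ?thesis unfolding fraction_def by (auto dest: transD)
  qed
  have eq: "fraction ?A S a s = fraction ?A S b t" if "fraction R S a s = fraction R S b t"
    "a \<in> A" "s \<in> S" "b \<in> A" "t \<in> S" for a s b t
    using that A.fraction_eq_iff[OF S, of a s b t] fraction_eq_iff[OF SA(1), of a s b t]
    by (simp add: minus Am sub AR)
  note simps = A.localization_simps[OF S, simplified] localization_simps[OF SA(1)]
  show ?thesis
  proof (rule ring_iso_memI)
    show "bij_betw (\<lambda>U. frac_rel R S `` U) (carrier (localization ?A S))
      (carrier ((localization R S)\<lparr>carrier := localization_subring R A S\<rparr>))"
      unfolding bij_betw_def
    proof
      show "inj_on (\<lambda>U. frac_rel R S `` U) (carrier (localization ?A S))"
        by (rule inj_onI, elim A.localization_cases[OF S])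
          (simp only:, rule eq; simp add: img)
      show "(\<lambda>U. frac_rel R S `` U) ` carrier (localization ?A S)
        = carrier ((localization R S)\<lparr>carrier := localization_subring R A S\<rparr>)"
      proof (intro equalityI subsetI)
        fix V assume "V \<in> (\<lambda>U. frac_rel R S `` U) ` carrier (localization ?A S)"
        then show "V \<in> carrier ((localization R S)\<lparr>carrier := localization_subring R A S\<rparr>)"
          by (fastforce simp: localization_subring_def img elim!: A.localization_cases[OF S])
      next
        fix V assume "V \<in> carrier ((localization R S)\<lparr>carrier := localization_subring R A S\<rparr>)"
        then obtain a s where as: "a \<in> A" "s \<in> S" "V = fraction R S a s"
          by (auto simp: localization_subring_def)
        then show "V \<in> (\<lambda>U. frac_rel R S `` U) ` carrier (localization ?A S)"
          using A.fraction_in_localization[OF S, of a s]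
          by (intro image_eqI[of _ _ "fraction ?A S a s"]) (simp_all add: img)
      qed
    qed
  next
    fix U assume "U \<in> carrier (localization ?A S)"
    then show "frac_rel R S `` U \<in> carrier ((localization R S)\<lparr>carrier := localization_subring R A S\<rparr>)"
      by (fastforce simp: localization_subring_def img elim!: A.localization_cases[OF S])
  next
    fix U V assume "U \<in> carrier (localization ?A S)" "V \<in> carrier (localization ?A S)"
    then obtain a s b t where *: "a \<in> A" "s \<in> S" "U = fraction ?A S a s"
      "b \<in> A" "t \<in> S" "V = fraction ?A S b t"
      by (elim A.localization_cases[OF S]) simp
    then show "frac_rel R S `` (U \<otimes>\<^bsub>localization ?A S\<^esub> V) = frac_rel R S `` U
        \<otimes>\<^bsub>(localization R S)\<lparr>carrier := localization_subring R A S\<rparr>\<^esub> frac_rel R S `` V"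
      and "frac_rel R S `` (U \<oplus>\<^bsub>localization ?A S\<^esub> V) = frac_rel R S `` U
        \<oplus>\<^bsub>(localization R S)\<lparr>carrier := localization_subring R A S\<rparr>\<^esub> frac_rel R S `` V"
      by (simp_all add: img simps Am sub AR Sm)
  next
    show "frac_rel R S `` \<one>\<^bsub>localization ?A S\<^esub>
        = \<one>\<^bsub>(localization R S)\<lparr>carrier := localization_subring R A S\<rparr>\<^esub>"
      by (simp add: img simps S1 subringE(3)[OF A])
  qed
qed

end


section \<open>Localization of an extension at a prime of the base ring\<close>

definition Spec :: "('a, 'c) ring_scheme \<Rightarrow> 'a set set"
  where "Spec R = {p. primeideal p R}"

definition MaxSpec :: "('a, 'c) ring_scheme \<Rightarrow> 'a set set"
  where "MaxSpec R = {m. maximalideal m R}"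

lemma (in cring) submonoid_Diff_prime:
  assumes A: "subring A R" and p: "p \<in> Spec (R\<lparr>carrier := A\<rparr>)"
  shows "submonoid (A - p) R"
proof -
  interpret p: primeideal p "R\<lparr>carrier := A\<rparr>" using p by (simp add: Spec_def)
  have "\<one> \<notin> p" using p.one_imp_carrier p.I_notcarr by auto
  moreover have "s \<in> p \<or> t \<in> p" if "s \<in> A" "t \<in> A" "s \<otimes> t \<in> p" for s t
    using p.I_prime[of s t] that by simp
  ultimately show ?thesis
    using subringE(1,3,6)[OF A] by (intro submonoid.intro) blast+
qed

text \<open>For an extension \<open>A \<subseteq> B\<close> and a prime \<open>\<pp>\<close> of \<open>A\<close>: the ring \<open>B\<^sub>\<pp>\<close> (note that the denominators
  are in \<open>A\<close>), its subring \<open>A\<^sub>\<pp>\<close>, and the element \<open>b/1\<close> of \<open>B\<^sub>\<pp>\<close>.\<close>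

abbreviation loc_ring :: "('a, 'c) ring_scheme \<Rightarrow> 'a set \<Rightarrow> 'a set \<Rightarrow> ('a \<times> 'a) set ring"
  where "loc_ring B A p \<equiv> localization B (A - p)"

abbreviation loc_base :: "('a, 'c) ring_scheme \<Rightarrow> 'a set \<Rightarrow> 'a set \<Rightarrow> ('a \<times> 'a) set set"
  where "loc_base B A p \<equiv> localization_subring B A (A - p)"

abbreviation loc_elem :: "('a, 'c) ring_scheme \<Rightarrow> 'a set \<Rightarrow> 'a set \<Rightarrow> 'a \<Rightarrow> ('a \<times> 'a) set"
  where "loc_elem B A p b \<equiv> fraction B (A - p) b \<one>\<^bsub>B\<^esub>"

end

theory Submission
  imports Defs
begin

text \<open>Let \<open>n = id\<^sub>A(b)\<close> and let \<open>I\<close> be the ideal of those \<open>s \<in> A\<close> for which \<open>s b\<^sup>n\<^sup>-\<^sup>1\<close> lies in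
  \<open>A + A b + \<dots> + A b\<^sup>n\<^sup>-\<^sup>2\<close>.  Minimality of \<open>n\<close> says that \<open>1 \<notin> I\<close>, so \<open>I\<close> lies in a maximal ideal
  \<open>\<mm>\<close>.  Clearing denominators in a monic equation of degree less than \<open>n\<close> for \<open>b/1\<close> over \<open>A\<^sub>\<mm>\<close> would
  give an element of \<open>I\<close> outside \<open>\<mm>\<close>.  In the other direction, dividing a monic equation of \<open>b\<close> by
  \<open>s\<^sup>n\<close> yields one for \<open>b/s\<close> of the same degree, so localizing never increases the integral
  degree.\<close>

text \<open>Zorn's lemma on the ideals that contain \<open>I\<close> and miss \<open>\<one>\<close>.
  Properness is expressed by \<open>\<one> \<notin> J\<close> because this condition visibly
  survives the union of a chain.\<close>

lemma (in cring) exists_maximalideal: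
  assumes I: "ideal I R" and proper: "\<one> \<notin> I"
  obtains M where "maximalideal M R" "I \<subseteq> M"
proof -
  let ?F = "{J. ideal J R \<and> I \<subseteq> J \<and> \<one> \<notin> J}"
  have "\<exists>M \<in> ?F. \<forall>J \<in> ?F. M \<subseteq> J \<longrightarrow> J = M"
  proof (rule subset_Zorn_nonempty)
    show "?F \<noteq> {}" using assms by blast
  next
    fix C assume ne: "C \<noteq> {}" and C: "subset.chain ?F C"
    then have "subset.chain {J. ideal J R} C"
      unfolding pred_on.chain_def by blast
    then have "ideal (\<Union>C) R"
      using chain_Union_is_ideal[of C] ne by simp
    then show "\<Union>C \<in> ?F"
      using ne C unfolding pred_on.chain_def by blast
  qed
  then obtain M where "M \<in> ?F" and max: "\<forall>J \<in> ?F. M \<subseteq> J \<longrightarrow> J = M" ..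
  then have M: "ideal M R" "I \<subseteq> M" "\<one> \<notin> M" by simp_all
  have "maximalideal M R"
  proof (rule maximalidealI[OF M(1)])
    show "carrier R \<noteq> M" using M(3) by blast
    show "J = M \<or> J = carrier R" if J: "ideal J R" "M \<subseteq> J" for J
    proof (cases "\<one> \<in> J")
      case True
      then show ?thesis using ideal.one_imp_carrier[OF J(1)] by simp
    next
      case False
      then show ?thesis using max J M(2) by blast
    qed
  qed
  then show ?thesis using that M(2) by blast
qed


section \<open>Monic equations\<close>

text \<open>\<open>pow_span R A b n\<close> is \<open>A + A b + \<dots> + A b\<^sup>n\<^sup>-\<^sup>1\<close>.\<close>

primrec pow_span :: "('a, 'c) ring_scheme \<Rightarrow> 'a set \<Rightarrow> 'a \<Rightarrow> nat \<Rightarrow> 'a set"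
  where
    "pow_span R A b 0 = {\<zero>\<^bsub>R\<^esub>}"
  | "pow_span R A b (Suc n) = {a \<otimes>\<^bsub>R\<^esub> b [^]\<^bsub>R\<^esub> n \<oplus>\<^bsub>R\<^esub> x | a x. a \<in> A \<and> x \<in> pow_span R A b n}"

lemma pow_span_SucI:
  "a \<in> A \<Longrightarrow> x \<in> pow_span R A b n \<Longrightarrow>
    a \<otimes>\<^bsub>R\<^esub> b [^]\<^bsub>R\<^esub> n \<oplus>\<^bsub>R\<^esub> x \<in> pow_span R A b (Suc n)"
  unfolding pow_span.simps by blast

text \<open>All lower terms are gathered in \<open>x\<close>, so the existence of a monic equation
  becomes a condition on \<open>b^n\<close> alone and no polynomial has to be carried along.\<close>

definition monic_eq :: "('a, 'c) ring_scheme \<Rightarrow> 'a set \<Rightarrow> 'a \<Rightarrow> nat \<Rightarrow> bool"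
  where "monic_eq R A b n \<longleftrightarrow> (\<exists>x \<in> pow_span R A b n. b [^]\<^bsub>R\<^esub> n \<oplus>\<^bsub>R\<^esub> x = \<zero>\<^bsub>R\<^esub>)"

text \<open>Here \<open>n\<close> is the exponent of the power multiplied by \<open>s\<close>; the
  ideal used for an element of integral degree \<open>d\<close> is the instance
  \<open>n = d - 1\<close>.\<close>

definition leading_ideal :: "('a, 'c) ring_scheme \<Rightarrow> 'a set \<Rightarrow> 'a \<Rightarrow> nat \<Rightarrow> 'a set"
  where "leading_ideal R A b n = {s \<in> A. s \<otimes>\<^bsub>R\<^esub> b [^]\<^bsub>R\<^esub> n \<in> pow_span R A b n}"

text \<open>Both \<open>eval\<close> and \<open>pow_span\<close> split off the leading term first.
  The lists have length exactly \<open>n\<close> and may begin with zeros, so they need not be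
  polynomials in the normalized sense.\<close>

lemma (in ring) pow_span_eq_eval:
  "pow_span R A b n = {eval p b | p. set p \<subseteq> A \<and> length p = n}"
proof (induction n)
  case 0
  then show ?case by simp
next
  case (Suc n)
  show ?case
  proof (intro equalityI subsetI)
    fix x assume "x \<in> pow_span R A b (Suc n)"
    then obtain a p where *: "a \<in> A" "set p \<subseteq> A" "length p = n" "x = a \<otimes> b [^] n \<oplus> eval p b"
      using Suc by auto
    then have "x = eval (a # p) b" "set (a # p) \<subseteq> A" "length (a # p) = Suc n" by auto
    then show "x \<in> {eval p b | p. set p \<subseteq> A \<and> length p = Suc n}" by blast
  next
    fix x assume "x \<in> {eval p b | p. set p \<subseteq> A \<and> length p = Suc n}"
    then obtain a p where "a \<in> A" "set p \<subseteq> A" "length p = n" "x = a \<otimes> b [^] n \<oplus> eval p b"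
      by (auto simp: length_Suc_conv)
    then show "x \<in> pow_span R A b (Suc n)"
      using Suc by (blast intro: pow_span_SucI)
  qed
qed

text \<open>A monic polynomial of degree \<open>n\<close> is \<open>\<one> # q\<close> with
  \<open>q\<close> an arbitrary list of \<open>n\<close> coefficients. The assumption
  \<open>\<one> \<noteq> \<zero>\<close> makes this list normalized.\<close>

lemma (in ring) monic_root_iff:
  assumes "\<one> \<noteq> \<zero>" "\<one> \<in> A" "b \<in> carrier R"
  shows "(\<exists>p \<in> monic_polys R A. degree p = n \<and> eval p b = \<zero>) \<longleftrightarrow> monic_eq R A b n"
proof
  assume "\<exists>p \<in> monic_polys R A. degree p = n \<and> eval p b = \<zero>"
  then obtain p where p: "polynomial A p" "p \<noteq> []" "lead_coeff p = \<one>" "degree p = n" "eval p b = \<zero>"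
    by (auto simp: monic_polys_def univ_poly_carrier)
  then obtain q where q: "p = \<one> # q" by (cases p) auto
  then have "eval q b \<in> pow_span R A b n" "b [^] n \<oplus> eval q b = \<zero>"
    using p assms(3) by (auto simp: pow_span_eq_eval polynomial_def)
  then show "monic_eq R A b n" unfolding monic_eq_def by blast
next
  assume "monic_eq R A b n"
  then obtain q where q: "set q \<subseteq> A" "length q = n" "b [^] n \<oplus> eval q b = \<zero>"
    by (auto simp: monic_eq_def pow_span_eq_eval)
  then have "\<one> # q \<in> monic_polys R A" "degree (\<one> # q) = n" "eval (\<one> # q) b = \<zero>"
    using assms by (auto simp: monic_polys_def univ_poly_carrier[symmetric] polynomial_def)
  then show "\<exists>p \<in> monic_polys R A. degree p = n \<and> eval p b = \<zero>" by blast
qed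

lemma (in ring) integral_degree_elem_eq:
  assumes "\<one> \<noteq> \<zero>" "\<one> \<in> A" "b \<in> carrier R"
  shows "integral_degree_elem R A b = (LEAST n. n \<ge> 1 \<and> monic_eq R A b n)"
  unfolding integral_degree_elem_def monic_root_iff[OF assms] ..

lemma (in ring) integral_degree_elem_le:
  assumes "\<one> \<noteq> \<zero>" "\<one> \<in> A" "b \<in> carrier R" "n \<ge> 1" "monic_eq R A b n"
  shows "integral_degree_elem R A b \<le> n"
  unfolding integral_degree_elem_eq[OF assms(1-3)] using assms(4,5) by (blast intro: Least_le)

text \<open>A monic equation of degree 0 would read 1 = 0.\<close>

lemma (in ring) monic_eq_pos:
  assumes "\<one> \<noteq> \<zero>" "monic_eq R A b n"
  shows "n \<ge> 1"
  using assms by (cases n) (auto simp: monic_eq_def)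

text \<open>One monic equation of any degree suffices for the minimum to exist, and then it is
  attained.\<close>

lemma (in ring) monic_eq_integral_degree_elem:
  assumes "\<one> \<noteq> \<zero>" "\<one> \<in> A" "b \<in> carrier R" "monic_eq R A b n"
  shows "integral_degree_elem R A b \<ge> 1" "monic_eq R A b (integral_degree_elem R A b)"
proof -
  have "n \<ge> 1 \<and> monic_eq R A b n" using monic_eq_pos assms by blast
  from LeastI[of "\<lambda>n. n \<ge> 1 \<and> monic_eq R A b n", OF this]
  show "integral_degree_elem R A b \<ge> 1" "monic_eq R A b (integral_degree_elem R A b)"
    unfolding integral_degree_elem_eq[OF assms(1-3)] by blast+
qed

lemma (in ring) integral_over_iff:
  assumes "\<one> \<noteq> \<zero>" "\<one> \<in> A" "b \<in> carrier R"
  shows "integral_over R A b \<longleftrightarrow> (\<exists>n. monic_eq R A b n)"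
  unfolding integral_over_def monic_root_iff[OF assms, symmetric] by blast

section \<open>The spans of powers as modules, and the ideals of leading coefficients\<close>

context cring
begin

context
  fixes A b
  assumes A: "subring A R" and b: "b \<in> carrier R"
begin

private lemma Ac: "a \<in> A \<Longrightarrow> a \<in> carrier R"
  using subringE(1)[OF A] by blast

lemma pow_span_closed: "x \<in> pow_span R A b n \<Longrightarrow> x \<in> carrier R"
  using Ac b by (induction n arbitrary: x) auto

lemma pow_span_zero: "\<zero> \<in> pow_span R A b n"
proof (induction n)
  case (Suc n)
  have "\<zero> \<otimes> b [^] n \<oplus> \<zero> = \<zero>" using b by simp
  then show ?case using pow_span_SucI[OF subringE(2)[OF A] Suc] by metis
qed simp

lemma pow_span_add:
  "x \<in> pow_span R A b n \<Longrightarrow> y \<in> pow_span R A b n \<Longrightarrow> x \<oplus> y \<in> pow_span R A b n"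
proof (induction n arbitrary: x y)
  case (Suc n)
  then obtain a u c v where *: "a \<in> A" "u \<in> pow_span R A b n" "x = a \<otimes> b [^] n \<oplus> u"
    "c \<in> A" "v \<in> pow_span R A b n" "y = c \<otimes> b [^] n \<oplus> v" by auto
  have "b [^] n \<in> carrier R" using b by simp
  then have "x \<oplus> y = (a \<oplus> c) \<otimes> b [^] n \<oplus> (u \<oplus> v)"
    unfolding *(3,6) using *(1,2,4,5) Ac pow_span_closed by algebra
  then show ?case
    using pow_span_SucI[OF subringE(7)[OF A *(1,4)] Suc.IH[OF *(2,5)]] by metis
qed simp

lemma pow_span_smult:
  "c \<in> A \<Longrightarrow> x \<in> pow_span R A b n \<Longrightarrow> c \<otimes> x \<in> pow_span R A b n"
proof (induction n arbitrary: x)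
  case (Suc n)
  then obtain a u where *: "a \<in> A" "u \<in> pow_span R A b n" "x = a \<otimes> b [^] n \<oplus> u" by auto
  have "b [^] n \<in> carrier R" using b by simp
  then have "c \<otimes> x = (c \<otimes> a) \<otimes> b [^] n \<oplus> c \<otimes> u"
    unfolding *(3) using *(1,2) Suc.prems(1) Ac pow_span_closed by algebra
  then show ?case
    using pow_span_SucI[OF subringE(6)[OF A Suc.prems(1) *(1)] Suc.IH[OF Suc.prems(1) *(2)]] by metis
qed (simp add: Ac)

text \<open>Multiplication by \<open>b\<close> raises every exponent by one and leaves the constant
  coefficient zero.\<close>

lemma pow_span_shift:
  "x \<in> pow_span R A b n \<Longrightarrow> b \<otimes> x \<in> pow_span R A b (Suc n)"
proof (induction n arbitrary: x)
  case 0
  then show ?case using pow_span_zero[of 1] b by simp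
next
  case (Suc n)
  then obtain a u where *: "a \<in> A" "u \<in> pow_span R A b n" "x = a \<otimes> b [^] n \<oplus> u" by auto
  have "b [^] n \<in> carrier R" using b by simp
  then have "b \<otimes> x = a \<otimes> (b [^] n \<otimes> b) \<oplus> b \<otimes> u"
    unfolding *(3) using *(1,2) b Ac pow_span_closed by algebra
  moreover have "b \<otimes> u \<in> pow_span R A b (Suc n)" by (rule Suc.IH[OF *(2)])
  ultimately show ?case using pow_span_SucI[OF *(1), of "b \<otimes> u" R b "Suc n"] by simp
qed

text \<open>Multiply a relation for \<open>s \<otimes> b^n\<close> by \<open>b\<close>. Thanks to
  this, one ideal, at exponent \<open>d - 1\<close>, controls the relations of all degrees below
  \<open>d\<close>.\<close>

lemma leading_ideal_mono:
  assumes "j \<le> n"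
  shows "leading_ideal R A b j \<subseteq> leading_ideal R A b n"
  using assms
proof (induction rule: dec_induct)
  case (step n)
  have "leading_ideal R A b n \<subseteq> leading_ideal R A b (Suc n)"
  proof
    fix s assume "s \<in> leading_ideal R A b n"
    then have s: "s \<in> A" "s \<otimes> b [^] n \<in> pow_span R A b n" by (auto simp: leading_ideal_def)
    have "s \<otimes> b [^] Suc n = b \<otimes> (s \<otimes> b [^] n)"
      using Ac[OF s(1)] b by (simp add: m_ac)
    then show "s \<in> leading_ideal R A b (Suc n)"
      using s pow_span_shift[OF s(2)] by (simp only: leading_ideal_def mem_Collect_eq)
  qed
  with step.IH show ?case by blast
qed simp

text \<open>It is the preimage of the \<open>A\<close>-submodule \<open>pow_span R A b n\<close>
  under the \<open>A\<close>-linear map sending \<open>s\<close> to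
  \<open>s \<otimes> b^n\<close>.\<close>

lemma ideal_leading_ideal: "ideal (leading_ideal R A b n) (R\<lparr>carrier := A\<rparr>)"
proof -
  interpret A: cring "R\<lparr>carrier := A\<rparr>"
    using subcring_iff[of A] subcringI'[OF A] subringE(1)[OF A] by blast
  have bn: "b [^] n \<in> carrier R" using b by simp
  show ?thesis
  proof (rule idealI[OF A.ring_axioms])
    show "subgroup (leading_ideal R A b n) (add_monoid (R\<lparr>carrier := A\<rparr>))"
    proof (rule A.add.subgroupI)
      show "leading_ideal R A b n \<subseteq> carrier (R\<lparr>carrier := A\<rparr>)" by (auto simp: leading_ideal_def)
      show "leading_ideal R A b n \<noteq> {}"
        using subringE(2)[OF A] pow_span_zero[of n] bn by (auto simp: leading_ideal_def intro!: exI[of _ \<zero>])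
      fix s assume "s \<in> leading_ideal R A b n"
      then have s: "s \<in> A" "s \<otimes> b [^] n \<in> pow_span R A b n" by (auto simp: leading_ideal_def)
      have eq: "\<ominus>\<^bsub>R\<lparr>carrier := A\<rparr>\<^esub> s = \<ominus> s"
        using s(1) subringE(5)[OF A] Ac by (intro A.minus_equality) (auto simp: l_neg)
      \<comment> \<open>Negation is multiplication by the scalar -1 of \<open>A\<close>, so closure
        under scalars covers it.\<close>
      have "(\<ominus> s) \<otimes> b [^] n = (\<ominus> \<one>) \<otimes> (s \<otimes> b [^] n)"
        using Ac[OF s(1)] bn by algebra
      moreover have "\<ominus> \<one> \<in> A" using subringE(3,5)[OF A] by blast
      ultimately show "\<ominus>\<^bsub>R\<lparr>carrier := A\<rparr>\<^esub> s \<in> leading_ideal R A b n"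
        unfolding eq using s pow_span_smult subringE(5)[OF A] by (simp add: leading_ideal_def)
      fix t assume "t \<in> leading_ideal R A b n"
      then have t: "t \<in> A" "t \<otimes> b [^] n \<in> pow_span R A b n" by (auto simp: leading_ideal_def)
      show "s \<oplus>\<^bsub>R\<lparr>carrier := A\<rparr>\<^esub> t \<in> leading_ideal R A b n"
        using s t bn Ac pow_span_add subringE(7)[OF A] by (simp add: leading_ideal_def l_distr)
    qed
    fix s c assume "s \<in> leading_ideal R A b n" and c: "c \<in> carrier (R\<lparr>carrier := A\<rparr>)"
    then have s: "s \<in> A" "s \<otimes> b [^] n \<in> pow_span R A b n" by (auto simp: leading_ideal_def)
    then show "c \<otimes>\<^bsub>R\<lparr>carrier := A\<rparr>\<^esub> s \<in> leading_ideal R A b n"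
      using c bn Ac pow_span_smult[of c] subringE(6)[OF A] by (simp add: leading_ideal_def m_assoc)
    then show "s \<otimes>\<^bsub>R\<lparr>carrier := A\<rparr>\<^esub> c \<in> leading_ideal R A b n"
      using c s Ac by (simp add: m_comm)
  qed
qed

lemma monic_eqI:
  assumes "x \<in> pow_span R A b n" "b [^] n = x"
  shows "monic_eq R A b n"
proof -
  have "\<ominus> \<one> \<in> A" using subringE(3,5)[OF A] by blast
  then have "(\<ominus> \<one>) \<otimes> x \<in> pow_span R A b n" using assms(1) pow_span_smult by blast
  moreover have "b [^] n \<oplus> (\<ominus> \<one>) \<otimes> x = \<zero>"
    using pow_span_closed[OF assms(1)] by (simp add: assms(2) l_minus r_neg)
  ultimately show ?thesis unfolding monic_eq_def by blast
qed

end

end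


section \<open>Monic equations in a localization\<close>

context cring
begin

context
  fixes A S
  assumes A: "subring A R" and S: "submonoid S R" and SA: "S \<subseteq> A"
begin

private lemma Acarr: "a \<in> A \<Longrightarrow> a \<in> carrier R"
  using subringE(1)[OF A] by blast

private lemma Sc: "s \<in> S \<Longrightarrow> s \<in> carrier R"
  and S1: "\<one> \<in> S"
  and Sm: "s \<in> S \<Longrightarrow> t \<in> S \<Longrightarrow> s \<otimes> t \<in> S"
  using submonoid.subset[OF S] submonoid.one_closed[OF S] submonoid.m_closed[OF S] by auto

private lemma Spow: "s \<in> S \<Longrightarrow> s [^] (n::nat) \<in> S"
  by (induction n) (auto simp: S1 Sm)

interpretation L: cring "localization R S"
  by (rule localization_cring[OF S])

lemma nat_pow_localization:
  assumes "b \<in> carrier R" "s \<in> S"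
  shows "fraction R S b s [^]\<^bsub>localization R S\<^esub> (n::nat) = fraction R S (b [^] n) (s [^] n)"
  using assms by (induction n) (simp_all add: localization_simps[OF S] Spow)

text \<open>If 1/1 = 0/1, some \<open>u\<close> in \<open>S\<close> satisfies
  \<open>u = \<zero>\<close>.\<close>

lemma one_neq_zero_localization:
  assumes "\<zero> \<notin> S"
  shows "\<one>\<^bsub>localization R S\<^esub> \<noteq> \<zero>\<^bsub>localization R S\<^esub>"
  using assms Sc S1 by (auto simp: localization_simps[OF S] fraction_eq_iff[OF S] minus_eq)

lemma one_in_localization_subring: "\<one>\<^bsub>localization R S\<^esub> \<in> localization_subring R A S"
  using S1 SA by (auto simp: localization_simps[OF S] localization_subring_def)

text \<open>The spare denominator \<open>t\<close> carries the induction: the step consumes one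
  factor \<open>s\<close> of the power, and the hypothesis is applied with
  \<open>s \<otimes> t\<close> in place of \<open>t\<close>.\<close>

lemma pow_span_localizationI:
  assumes "b \<in> carrier R" "s \<in> S"
  shows "x \<in> pow_span R A b n \<Longrightarrow> t \<in> S \<Longrightarrow>
    fraction R S x (s [^] n \<otimes> t) \<in> pow_span (localization R S) (localization_subring R A S) (fraction R S b s) n"
proof (induction n arbitrary: x t)
  case 0
  then have "fraction R S \<zero> t = fraction R S \<zero> \<one>"
    by (intro fraction_eqI[OF S]) (simp_all add: Sc S1)
  then show ?case using 0 Sc by (simp add: localization_simps[OF S])
next
  case (Suc n)
  then obtain a u where *: "a \<in> A" "u \<in> pow_span R A b n" "x = a \<otimes> b [^] n \<oplus> u" by auto
  define r where "r = s [^] n"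
  define c where "c = b [^] n"
  have car: "a \<in> carrier R" "u \<in> carrier R" "r \<in> S" "c \<in> carrier R" "s \<in> S" "t \<in> S" "s \<in> carrier R"
      "t \<in> carrier R" "r \<in> carrier R"
    using * Acarr pow_span_closed[OF A assms(1)] Spow assms Suc.prems Sc by (auto simp: r_def c_def)
  \<comment> \<open>These are the two parts of (a b^n + u) / (s^(n+1) t) = (a / (s t)) (b/s)^n + u /
    (s^n (s t)).\<close>
  let ?a = "fraction R S a (s \<otimes> t)" and ?u = "fraction R S u (r \<otimes> (s \<otimes> t))"
  have "fraction R S x (s [^] Suc n \<otimes> t) = ?a \<otimes>\<^bsub>localization R S\<^esub>
      (fraction R S b s [^]\<^bsub>localization R S\<^esub> n) \<oplus>\<^bsub>localization R S\<^esub> ?u"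
    unfolding *(3) nat_pow_localization[OF assms] nat_pow_Suc r_def[symmetric] c_def[symmetric]
    using car(3,5,6)
    by (simp add: car localization_simps[OF S] Sm)
      (intro fraction_eqI[OF S]; (simp add: car Sm; fail)?; use car in algebra)
  moreover have "?a \<in> localization_subring R A S"
    using *(1) car Sm by (auto simp: localization_subring_def)
  moreover have "?u \<in> pow_span (localization R S) (localization_subring R A S) (fraction R S b s) n"
    unfolding r_def using Suc.IH[OF *(2)] car Sm by blast
  ultimately show ?case unfolding pow_span.simps by blast
qed

text \<open>Bring all coefficients to a common denominator. Powers of b/1 contribute no denominators
  of their own.\<close>

lemma pow_span_localizationE:
  assumes "b \<in> carrier R"
  shows "y \<in> pow_span (localization R S) (localization_subring R A S) (fraction R S b \<one>) n \<Longrightarrow>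
    \<exists>x \<in> pow_span R A b n. \<exists>t \<in> S. y = fraction R S x t"
proof (induction n arbitrary: y)
  case 0
  then show ?case using S1 by (auto simp: localization_simps[OF S])
next
  case (Suc n)
  let ?L = "localization R S"
  obtain v z where v: "v \<in> localization_subring R A S"
    and z: "z \<in> pow_span ?L (localization_subring R A S) (fraction R S b \<one>) n"
    and y: "y = v \<otimes>\<^bsub>?L\<^esub> (fraction R S b \<one> [^]\<^bsub>?L\<^esub> n) \<oplus>\<^bsub>?L\<^esub> z"
    using Suc.prems by auto
  obtain a s where as: "a \<in> A" "s \<in> S" "v = fraction R S a s"
    using v by (auto simp: localization_subring_def)
  obtain x t where xt: "x \<in> pow_span R A b n" "t \<in> S" "z = fraction R S x t"
    using Suc.IH[OF z] by blast
  have car: "a \<in> carrier R" "x \<in> carrier R" "b [^] n \<in> carrier R"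
    using as xt Acarr assms pow_span_closed[OF A assms] by auto
  have "y = fraction R S ((t \<otimes> a) \<otimes> b [^] n \<oplus> s \<otimes> x) (s \<otimes> t)"
    unfolding y as(3) xt(3) nat_pow_localization[OF assms S1]
    using car as(2) xt(2) by (simp add: localization_simps[OF S] S1 Sm Sc m_assoc)
  \<comment> \<open>The new numerator stays in the span because the denominators \<open>s\<close>
    and \<open>t\<close> lie in \<open>A\<close>.\<close>
  moreover have "(t \<otimes> a) \<otimes> b [^] n \<oplus> s \<otimes> x \<in> pow_span R A b (Suc n)"
    using as xt SA by (intro pow_span_SucI subringE(6)[OF A] pow_span_smult[OF A assms]) auto
  ultimately show ?case using Sm as xt by blast
qed

lemma monic_eq_localization:
  assumes "b \<in> carrier R" "s \<in> S" "monic_eq R A b n"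
  shows "monic_eq (localization R S) (localization_subring R A S) (fraction R S b s) n"
proof -
  obtain x where x: "x \<in> pow_span R A b n" "b [^] n \<oplus> x = \<zero>"
    using assms(3) by (auto simp: monic_eq_def)
  define r where "r = s [^] n"
  have r: "r \<in> S" "r \<in> carrier R" "x \<in> carrier R"
    using Spow assms Sc pow_span_closed[OF A] x by (auto simp: r_def)
  \<comment> \<open>The lower part of the new equation is x / s^n, obtained with spare denominator
    1.\<close>
  have "fraction R S x r \<in> pow_span (localization R S) (localization_subring R A S) (fraction R S b s) n"
    using pow_span_localizationI[OF assms(1,2) x(1) S1] r by (simp add: r_def)
  moreover have "fraction R S b s [^]\<^bsub>localization R S\<^esub> n \<oplus>\<^bsub>localization R S\<^esub> fraction R S x r
    = \<zero>\<^bsub>localization R S\<^esub>"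
  proof -
    have "r \<otimes> b [^] n \<oplus> r \<otimes> x = \<zero>"
      using r x(2) assms(1) by (simp flip: r_distr)
    then show ?thesis
      unfolding nat_pow_localization[OF assms(1,2)] r_def[symmetric]
      by (simp add: r assms localization_simps[OF S])
        (intro fraction_eqI[OF S]; simp add: r Sm S1)
  qed
  ultimately show ?thesis unfolding monic_eq_def by blast
qed

text \<open>An equation b^n/1 + x/t = 0 means u (t b^n + x) = 0 for some \<open>u\<close> in
  \<open>S\<close>. Then (u t) b^n = -u x lies in the span of the lower powers, and u t is the
  required element.\<close>

lemma monic_eq_localizationD:
  assumes "b \<in> carrier R"
    and "monic_eq (localization R S) (localization_subring R A S) (fraction R S b \<one>) n"
  shows "leading_ideal R A b n \<inter> S \<noteq> {}"
proof -
  obtain x t where x: "x \<in> pow_span R A b n" "t \<in> S"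
    and e: "fraction R S b \<one> [^]\<^bsub>localization R S\<^esub> n \<oplus>\<^bsub>localization R S\<^esub> fraction R S x t
      = \<zero>\<^bsub>localization R S\<^esub>"
    using assms(2) pow_span_localizationE[OF assms(1)] unfolding monic_eq_def by blast
  define c where "c = b [^] n"
  have c: "c \<in> carrier R" "x \<in> carrier R" "t \<in> carrier R"
    using x assms(1) Sc pow_span_closed[OF A] by (auto simp: c_def)
  have "fraction R S (t \<otimes> c \<oplus> x) t = fraction R S \<zero> \<one>"
    using e c x(2) unfolding nat_pow_localization[OF assms(1) S1] c_def[symmetric]
    by (simp add: localization_simps[OF S] S1)
  then obtain u where u: "u \<in> S" "u \<otimes> (t \<otimes> c \<oplus> x) = \<zero>"
    using c x(2) S1 by (auto simp: fraction_eq_iff[OF S] minus_eq)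
  have "u \<otimes> t \<otimes> c = u \<otimes> (t \<otimes> c \<oplus> x) \<oplus> (\<ominus> u) \<otimes> x"
    using c Sc[OF u(1)] by algebra
  also have "\<dots> = (\<ominus> u) \<otimes> x" using u c Sc by simp
  also have "\<dots> \<in> pow_span R A b n"
    using u(1) SA subringE(5)[OF A] x(1) by (intro pow_span_smult[OF A assms(1)]) auto
  finally have "u \<otimes> t \<in> leading_ideal R A b n"
    using u(1) x(2) SA Sm by (auto simp: leading_ideal_def c_def)
  then show ?thesis using Sm u(1) x(2) by blast
qed

end

end


section \<open>The integral degree under localization\<close>

context
  fixes B :: "('a, 'c) ring_scheme" and A :: "'a set"
  assumes dom: "domain B" and A: "subring A B" and int: "integral_extension B A"
begin

interpretation B: domain B by (rule dom)

interpretation A: cring "B\<lparr>carrier := A\<rparr>"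
  using B.subcring_iff[of A] B.subcringI'[OF A] subringE(1)[OF A] by blast

lemma Max_subset_Spec: "MaxSpec (B\<lparr>carrier := A\<rparr>) \<subseteq> Spec (B\<lparr>carrier := A\<rparr>)"
  by (auto simp: MaxSpec_def Spec_def A.maximalideal_prime)

lemma monic_eq_integral_degree:
  assumes "b \<in> carrier B"
  shows "integral_degree_elem B A b \<ge> 1" "monic_eq B A b (integral_degree_elem B A b)"
proof -
  obtain n where "monic_eq B A b n"
    using int B.integral_over_iff[OF B.one_not_zero subringE(3)[OF A] assms] assms
    unfolding integral_extension_def by blast
  from B.monic_eq_integral_degree_elem[OF B.one_not_zero subringE(3)[OF A] assms this]
  show "integral_degree_elem B A b \<ge> 1" "monic_eq B A b (integral_degree_elem B A b)"
    by blast+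
qed

lemma zero_notin_Diff_prime: "p \<in> Spec (B\<lparr>carrier := A\<rparr>) \<Longrightarrow> \<zero>\<^bsub>B\<^esub> \<notin> A - p"
  using additive_subgroup.zero_closed[of p "B\<lparr>carrier := A\<rparr>"] ideal.axioms(1) primeideal.axioms(1)
  by (fastforce simp: Spec_def)

text \<open>A monic equation of least degree for \<open>b\<close> passes to b/s. All denominators
  \<open>s\<close> are allowed, since every element of the localized ring must be bounded.\<close>

lemma integral_degree_elem_localization_le:
  assumes p: "p \<in> Spec (B\<lparr>carrier := A\<rparr>)" and b: "b \<in> carrier B" and s: "s \<in> A - p"
  shows "integral_degree_elem (loc_ring B A p) (loc_base B A p) (fraction B (A - p) b s)
    \<le> integral_degree_elem B A b"
proof -
  have S: "submonoid (A - p) B" by (rule B.submonoid_Diff_prime[OF A p])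
  interpret L: cring "loc_ring B A p" by (rule B.localization_cring[OF S])
  show ?thesis
  proof (rule L.integral_degree_elem_le)
    show "\<one>\<^bsub>loc_ring B A p\<^esub> \<noteq> \<zero>\<^bsub>loc_ring B A p\<^esub>"
      by (rule B.one_neq_zero_localization[OF A S Diff_subset zero_notin_Diff_prime[OF p]])
    show "\<one>\<^bsub>loc_ring B A p\<^esub> \<in> loc_base B A p"
      by (rule B.one_in_localization_subring[OF A S Diff_subset])
    show "fraction B (A - p) b s \<in> carrier (loc_ring B A p)"
      by (rule B.fraction_in_localization[OF S b s])
  qed (use monic_eq_integral_degree[OF b] B.monic_eq_localization[OF A S Diff_subset b s] in blast)+
qed

lemma integral_degree_localization_le:
  assumes p: "p \<in> Spec (B\<lparr>carrier := A\<rparr>)"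
  shows "integral_degree (loc_ring B A p) (loc_base B A p) \<le> integral_degree B A"
  unfolding integral_degree_def
proof (rule SUP_least)
  fix U assume "U \<in> carrier (loc_ring B A p)"
  then obtain b s where "b \<in> carrier B" "s \<in> A - p" "U = fraction B (A - p) b s"
    by (rule B.localization_cases[OF B.submonoid_Diff_prime[OF A p]])
  then show "enat (integral_degree_elem (loc_ring B A p) (loc_base B A p) U)
      \<le> (SUP b \<in> carrier B. enat (integral_degree_elem B A b))"
    using integral_degree_elem_localization_le[OF p, of b s] by (intro SUP_upper2[of b]) simp_all
qed

lemma exists_max_integral_degree_elem:
  assumes b: "b \<in> carrier B"
  shows "\<exists>m \<in> MaxSpec (B\<lparr>carrier := A\<rparr>). integral_degree_elem B A b
    = integral_degree_elem (loc_ring B A m) (loc_base B A m) (loc_elem B A m b)"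
proof -
  let ?n = "integral_degree_elem B A b"
  let ?I = "leading_ideal B A b (?n - 1)"
  \<comment> \<open>Otherwise b^(n-1) is in the span of the lower powers, which is a monic equation
    of degree n - 1 and contradicts minimality.\<close>
  have "\<one>\<^bsub>B\<^esub> \<notin> ?I"
  proof
    assume one: "\<one>\<^bsub>B\<^esub> \<in> ?I"
    then have "b [^]\<^bsub>B\<^esub> (?n - 1) \<in> pow_span B A b (?n - 1)"
      using b by (simp add: leading_ideal_def)
    then have m: "monic_eq B A b (?n - 1)" using B.monic_eqI[OF A b] by blast
    then have "?n \<le> ?n - 1"
      \<comment> \<open>This covers n = 1, where the equation would have degree 0.\<close>
      using B.monic_eq_pos[OF B.one_not_zero m]
      by (intro B.integral_degree_elem_le[OF B.one_not_zero subringE(3)[OF A] b])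
    then show False using monic_eq_integral_degree(1)[OF b] by simp
  qed
  then obtain m where m: "maximalideal m (B\<lparr>carrier := A\<rparr>)" "?I \<subseteq> m"
    using A.exists_maximalideal[OF B.ideal_leading_ideal[OF A b]] by auto
  then have mM: "m \<in> MaxSpec (B\<lparr>carrier := A\<rparr>)" by (simp add: MaxSpec_def)
  then have mS: "m \<in> Spec (B\<lparr>carrier := A\<rparr>)" using Max_subset_Spec by blast
  have S: "submonoid (A - m) B" by (rule B.submonoid_Diff_prime[OF A mS])
  note one_in = submonoid.one_closed[OF S]
  interpret L: cring "loc_ring B A m" by (rule B.localization_cring[OF S])
  let ?k = "integral_degree_elem (loc_ring B A m) (loc_base B A m) (loc_elem B A m b)"
  \<comment> \<open>The localized equation of \<open>b\<close> is monic, so the minimum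
    \<open>?k\<close> is attained.\<close>
  have "monic_eq (loc_ring B A m) (loc_base B A m) (loc_elem B A m b) ?k"
    by (rule L.monic_eq_integral_degree_elem(2)[OF
          B.one_neq_zero_localization[OF A S Diff_subset zero_notin_Diff_prime[OF mS]]
          B.one_in_localization_subring[OF A S Diff_subset]
          B.fraction_in_localization[OF S b one_in]
          B.monic_eq_localization[OF A S Diff_subset b one_in monic_eq_integral_degree(2)[OF b]]])
  then have "leading_ideal B A b ?k \<inter> (A - m) \<noteq> {}"
    by (rule B.monic_eq_localizationD[OF A S Diff_subset b])
  \<comment> \<open>Otherwise monotonicity would place an element outside \<open>m\<close> in
    \<open>?I\<close>, although \<open>?I\<close> is contained in \<open>m\<close>.\<close>
  then have "\<not> ?k \<le> ?n - 1"
    using B.leading_ideal_mono[OF A b, of ?k "?n - 1"] m(2) by blast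
  then have "?n \<le> ?k" by linarith
  moreover have "?k \<le> ?n" by (rule integral_degree_elem_localization_le[OF mS b one_in])
  ultimately show ?thesis using mM by (intro bexI[of _ m]) auto
qed

section \<open>From single elements to the suprema\<close>

lemma integral_degree_elem_le_localization:
  assumes "b \<in> carrier B"
  obtains m where "m \<in> MaxSpec (B\<lparr>carrier := A\<rparr>)"
    "enat (integral_degree_elem B A b) \<le> integral_degree (loc_ring B A m) (loc_base B A m)"
proof -
  obtain m where m: "m \<in> MaxSpec (B\<lparr>carrier := A\<rparr>)" "integral_degree_elem B A b
    = integral_degree_elem (loc_ring B A m) (loc_base B A m) (loc_elem B A m b)"
    using exists_max_integral_degree_elem[OF assms] by blast
  have S: "submonoid (A - m) B" using B.submonoid_Diff_prime[OF A] m(1) Max_subset_Spec by blast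
  have "loc_elem B A m b \<in> carrier (loc_ring B A m)"
    by (rule B.fraction_in_localization[OF S assms submonoid.one_closed[OF S]])
  then have "enat (integral_degree_elem B A b) \<le> integral_degree (loc_ring B A m) (loc_base B A m)"
    unfolding m(2) integral_degree_def by (rule SUP_upper)
  then show ?thesis by (rule that[OF m(1)])
qed

lemma integral_degree_le_SUP_MaxSpec:
  "integral_degree B A
    \<le> (SUP m \<in> MaxSpec (B\<lparr>carrier := A\<rparr>). integral_degree (loc_ring B A m) (loc_base B A m))"
  unfolding integral_degree_def[of B A]
proof (rule SUP_least)
  fix b assume "b \<in> carrier B"
  then obtain m where "m \<in> MaxSpec (B\<lparr>carrier := A\<rparr>)"
    "enat (integral_degree_elem B A b) \<le> integral_degree (loc_ring B A m) (loc_base B A m)"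
    by (rule integral_degree_elem_le_localization)
  then show "enat (integral_degree_elem B A b)
      \<le> (SUP m \<in> MaxSpec (B\<lparr>carrier := A\<rparr>). integral_degree (loc_ring B A m) (loc_base B A m))"
    by (rule SUP_upper2)
qed

text \<open>The lower bound comes from the maximal ideals and the upper bound holds at every prime.
  Any set \<open>P\<close> in between gives the same supremum, which treats \<open>MaxSpec\<close>
  and \<open>Spec\<close> together.\<close>

lemma integral_degree_eq_SUP:
  assumes "MaxSpec (B\<lparr>carrier := A\<rparr>) \<subseteq> P" "P \<subseteq> Spec (B\<lparr>carrier := A\<rparr>)"
  shows "integral_degree B A = (SUP p \<in> P. integral_degree (loc_ring B A p) (loc_base B A p))"
proof (rule antisym)
  show "integral_degree B A \<le> (SUP p \<in> P. integral_degree (loc_ring B A p) (loc_base B A p))"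
    using integral_degree_le_SUP_MaxSpec SUP_subset_mono[OF assms(1) order_refl] by (rule order_trans)
  show "(SUP p \<in> P. integral_degree (loc_ring B A p) (loc_base B A p)) \<le> integral_degree B A"
    using integral_degree_localization_le assms(2) by (intro SUP_least) blast
qed

text \<open>A finite degree is the integral degree of a single element \<open>b\<close>. At the
  maximal ideal found for this \<open>b\<close>, the local degree is at least that of
  \<open>b\<close> and at most the global one.\<close>

lemma integral_degree_attained:
  assumes "integral_degree B A \<noteq> \<infinity>"
  shows "\<exists>m \<in> MaxSpec (B\<lparr>carrier := A\<rparr>).
    integral_degree B A = integral_degree (loc_ring B A m) (loc_base B A m)"
proof -
  let ?D = "(\<lambda>b. enat (integral_degree_elem B A b)) ` carrier B"
  have ne: "?D \<noteq> {}" by auto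
  \<comment> \<open>The supremum of a nonempty set of extended naturals is its maximum if the set is
    finite and \<infinity> otherwise.\<close>
  then have "finite ?D" "integral_degree B A = Max ?D"
    using assms by (auto simp: integral_degree_def Sup_enat_def split: if_splits)
  then obtain b where b: "b \<in> carrier B" "integral_degree B A = enat (integral_degree_elem B A b)"
    using Max_in[OF _ ne] by auto
  obtain m where m: "m \<in> MaxSpec (B\<lparr>carrier := A\<rparr>)"
    "enat (integral_degree_elem B A b) \<le> integral_degree (loc_ring B A m) (loc_base B A m)"
    using integral_degree_elem_le_localization[OF b(1)] .
  moreover have "integral_degree (loc_ring B A m) (loc_base B A m) \<le> integral_degree B A"
    using integral_degree_localization_le m(1) Max_subset_Spec by blast
  ultimately show ?thesis using b(2) by (intro bexI[of _ m]) auto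
qed

end

theorem proposition2p9:
  fixes B :: "('a, 'c) ring_scheme" and A :: "'a set"
  assumes "domain B" and "subring A B" and "integral_extension B A"
  shows
    "(\<forall>b \<in> carrier B. \<exists>m \<in> MaxSpec (B\<lparr>carrier := A\<rparr>).
        integral_degree_elem B A b
          = integral_degree_elem (loc_ring B A m) (loc_base B A m) (loc_elem B A m b)) \<and>
     integral_degree B A
       = (SUP m \<in> MaxSpec (B\<lparr>carrier := A\<rparr>). integral_degree (loc_ring B A m) (loc_base B A m)) \<and>
     integral_degree B A
       = (SUP p \<in> Spec (B\<lparr>carrier := A\<rparr>). integral_degree (loc_ring B A p) (loc_base B A p)) \<and>
     (integral_degree B A \<noteq> \<infinity> \<longrightarrow>
        (\<exists>m \<in> MaxSpec (B\<lparr>carrier := A\<rparr>).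
           integral_degree B A = integral_degree (loc_ring B A m) (loc_base B A m)))"
  using exists_max_integral_degree_elem[OF assms] Max_subset_Spec[OF assms]
    integral_degree_eq_SUP[OF assms] integral_degree_attained[OF assms]
  by blast

end
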